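(* Let $X$ be a regular topological space with countable tightness and let $Y$ be a non-separable subspace of $X$. If all finite powers of $X$ are Lindelöf, then there exist a c.c.c. poset $\mathbb{P}$ and a family $\mathcal{D}$ of dense subsets of $\mathbb{P}$ with $|\mathcal{D}|=\omega_1$ such that, if there exists a filter $G\subset\mathbb{P}$ meeting each $D\in\mathcal{D}$, then $Y$ has an uncountable discrete subspace. Consequently, if $\mathrm{MA}_{\omega_1}$ holds and $X$ is a regular topological space with countable tightness containing a subspace which is an $L$-space, then some finite power of $X$ is not Lindelöf.
   Context: All topological spaces are assumed to be Tychonoff. An $L$-space is a regular hereditarily Lindelöf nonseparable topological space. $\mathrm{MA}_{\omega_1}$ is Martin's Axiom for families of $\omega_1$ many dense sets. A space $X$ has countable tightness if whenever $x\in\overline{A}$, $A\subset X$, there is a countable $B\subset A$ with $x\in\overline{B}$. *)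

theory Defs
  imports "HOL-Analysis.Analysis"
begin

(* Spaces are 'a topology; subspaces are subtopology X S; the library's regular_space does not
   include any T1 axiom, so t1_space is always stated separately.  Posets are a carrier set P with
   an order relation le, where (q, p) \<in> le is read "q \<le> p", i.e. q is the stronger condition. *)

definition countably_tight :: "'a topology \<Rightarrow> bool" where
  "countably_tight X \<longleftrightarrow>
     (\<forall>A x. A \<subseteq> topspace X \<longrightarrow> x \<in> X closure_of A \<longrightarrow>
        (\<exists>B. B \<subseteq> A \<and> countable B \<and> x \<in> X closure_of B))"

definition hereditarily_Lindelof :: "'a topology \<Rightarrow> bool" where
  "hereditarily_Lindelof X \<longleftrightarrow> (\<forall>S. S \<subseteq> topspace X \<longrightarrow> Lindelof_space (subtopology X S))"

definition L_space :: "'a topology \<Rightarrow> bool" where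
  "L_space X \<longleftrightarrow>
     regular_space X \<and> t1_space X \<and> hereditarily_Lindelof X \<and> \<not> separable_space X"

definition power_topology :: "'a topology \<Rightarrow> nat \<Rightarrow> (nat \<Rightarrow> 'a) topology" where
  "power_topology X n = product_topology (\<lambda>_. X) {..<n}"

definition has_uncountable_discrete_subspace :: "'a topology \<Rightarrow> bool" where
  "has_uncountable_discrete_subspace Y \<longleftrightarrow>
     (\<exists>S. S \<subseteq> topspace Y \<and> uncountable S \<and> subtopology Y S = discrete_topology S)"

definition compatible_in :: "'p set \<Rightarrow> ('p \<times> 'p) set \<Rightarrow> 'p \<Rightarrow> 'p \<Rightarrow> bool" where
  "compatible_in P le p q \<longleftrightarrow> (\<exists>r\<in>P. (r, p) \<in> le \<and> (r, q) \<in> le)"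

definition ccc_poset :: "'p set \<Rightarrow> ('p \<times> 'p) set \<Rightarrow> bool" where
  "ccc_poset P le \<longleftrightarrow>
     P \<noteq> {} \<and> partial_order_on P le \<and>
     (\<forall>A. A \<subseteq> P \<longrightarrow> (\<forall>p\<in>A. \<forall>q\<in>A. p \<noteq> q \<longrightarrow> \<not> compatible_in P le p q) \<longrightarrow> countable A)"

definition dense_in_poset :: "'p set \<Rightarrow> ('p \<times> 'p) set \<Rightarrow> 'p set \<Rightarrow> bool" where
  "dense_in_poset P le D \<longleftrightarrow> D \<subseteq> P \<and> (\<forall>p\<in>P. \<exists>d\<in>D. (d, p) \<in> le)"

definition filter_in_poset :: "'p set \<Rightarrow> ('p \<times> 'p) set \<Rightarrow> 'p set \<Rightarrow> bool" where
  "filter_in_poset P le G \<longleftrightarrow>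
     G \<subseteq> P \<and> G \<noteq> {} \<and>
     (\<forall>p\<in>G. \<forall>q\<in>P. (p, q) \<in> le \<longrightarrow> q \<in> G) \<and>
     (\<forall>p\<in>G. \<forall>q\<in>G. \<exists>r\<in>G. (r, p) \<in> le \<and> (r, q) \<in> le)"

abbreviation omega1 :: "nat set rel" where
  "omega1 \<equiv> cardSuc natLeq"

(* Martin's Axiom for posets whose conditions are drawn from the type 'p.  A formula cannot quantify
   over types, so 'p is a parameter.  For uncountable 'p this is the full axiom, because
   MA for omega_1 dense sets reduces to posets of size at most omega_1; for countable 'p it is
   a weaker principle, hence the uncountability assumption wherever this is used. *)
definition MA_omega1 :: "'p itself \<Rightarrow> bool" where
  "MA_omega1 (_ :: 'p itself) \<longleftrightarrow>
     (\<forall>(P :: 'p set) le \<D>.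
        ccc_poset P le \<longrightarrow> (\<forall>D\<in>\<D>. dense_in_poset P le D) \<longrightarrow> (card_of \<D>, omega1) \<in> ordLeq \<longrightarrow>
        (\<exists>G. filter_in_poset P le G \<and> (\<forall>D\<in>\<D>. G \<inter> D \<noteq> {})))"

end

theory Submission
  imports Defs "HOL-Library.Countable_Set_Type"
begin

unbundle cardinal_syntax

text \<open>
  A nonseparable \<open>Y\<close> contains a left-separated sequence \<open>y\<close> of length \<open>\<omega>\<^sub>1\<close>: no \<open>y a\<close> lies in the
  closure of \<open>{y b | b < a}\<close>.  Regularity gives each \<open>y a\<close> an open neighbourhood \<open>U a\<close> whose closure
  is disjoint from the closure of \<open>{y b | b < a}\<close>
  (\<open>nonseparable_separating_neighbourhoods\<close>).  So \<open>U a\<close> contains no earlier point of the sequence, and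
  an uncountable set of indices \<open>A\<close> with \<open>y a \<notin> U b\<close> for all distinct \<open>a, b \<in> A\<close> yields an uncountable
  discrete subspace of \<open>Y\<close>.  The conditions of the poset are the finite approximations to such an
  \<open>A\<close>, ordered by reverse inclusion.

  The heart of the matter is the countable chain condition (\<open>separation_conditions_ccc\<close>).  By the
  delta system lemma, uncountably many conditions may be taken to be \<open>m\<close>-element sets that are
  pairwise disjoint, apart from a common root, which causes no conflict.  Listing its elements, each
  such set gives a point of the power \<open>X\<^sup>m\<close>.  That power is Lindelof, so these points have a condensation
  point \<open>z\<close>.  Each coordinate of \<open>z\<close> lies in the closure of the whole sequence, hence by countable
  tightness in the closure of a countable initial segment, and all coordinates lie in the closure of
  \<open>{y b | b < c}\<close> for a single \<open>c\<close>.  Let \<open>p\<close> be a condition of the family all of whose indices outside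
  the root are at least \<open>c\<close>.  For such an index \<open>a\<close> the closure of \<open>U a\<close> misses all coordinates of \<open>z\<close>;
  so uncountably many of the points have all coordinates outside these finitely many closures.  One of
  them belongs to a condition \<open>q\<close> whose indices outside the root are above all of \<open>p\<close>, and then \<open>p \<union> q\<close>
  is a condition.

  A ccc poset of finite sets containing all singletons has an element below which the sets
  \<open>D a\<close> of conditions that reach above \<open>a\<close> are dense, for all \<open>a < \<omega>\<^sub>1\<close>
  (\<open>ccc_omega_1_condition_forcing_unbounded\<close>).  The union of a filter meeting all of them is
  uncountable.  There are only \<open>\<omega>\<^sub>1\<close> conditions, so the poset can be carried over to any
  uncountable type.  The second part follows because an L-space is nonseparable, while a hereditarily
  Lindelof space has no uncountable discrete subspace.
\<close>

section \<open>The first uncountable ordinal as a type\<close>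

lemma uncountable_iff_omega1_ordLeq: "uncountable A \<longleftrightarrow> omega1 \<le>o |A|"
proof -
  have "uncountable A \<longleftrightarrow> natLeq <o |A|"
    unfolding countable_card_le_natLeq
    by (rule not_ordLeq_iff_ordLess[OF natLeq_Well_order card_of_Well_order])
  also have "\<dots> \<longleftrightarrow> omega1 \<le>o |A|"
    by (rule cardSuc_ordLess_ordLeq[OF natLeq_Card_order card_of_Card_order])
  finally show ?thesis .
qed

text \<open>Making \<open>\<omega>\<^sub>1\<close> a type of class \<open>wellorder\<close> gives access to the order notation, to
  \<open>less_induct\<close> and to sorted enumerations of finite sets.\<close>

typedef omega_1 = "Field omega1"
  using Field_cardSuc_not_empty natLeq_Card_order by blast

instantiation omega_1 :: linorder
begin


definition less_eq_omega_1 :: "omega_1 \<Rightarrow> omega_1 \<Rightarrow> bool" where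
  "a \<le> b \<longleftrightarrow> (Rep_omega_1 a, Rep_omega_1 b) \<in> omega1"

definition less_omega_1 :: "omega_1 \<Rightarrow> omega_1 \<Rightarrow> bool" where
  "(a :: omega_1) < b \<longleftrightarrow> a \<le> b \<and> a \<noteq> b"

instance
proof
  have wo: "Well_order omega1"
    using cardSuc_Well_order natLeq_Card_order by blast
  then have refl: "refl_on (Field omega1) omega1" and trans: "trans omega1"
    and antisym: "antisym omega1" and total: "total_on (Field omega1) omega1"
    by (auto simp: well_order_on_def linear_order_on_def partial_order_on_def preorder_on_def)
  fix a b c :: omega_1
  show "a \<le> a"
    using refl Rep_omega_1 unfolding less_eq_omega_1_def refl_on_def by blast
  show "a = b" if "a \<le> b" "b \<le> a"
    using that antisym unfolding less_eq_omega_1_def antisym_def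
    by (metis Rep_omega_1_inject)
  show "a < b \<longleftrightarrow> a \<le> b \<and> \<not> b \<le> a"
    using antisym refl unfolding less_omega_1_def less_eq_omega_1_def antisym_def refl_on_def
    by (metis Rep_omega_1 Rep_omega_1_inject)
  show "a \<le> c" if "a \<le> b" "b \<le> c"
    using that trans unfolding less_eq_omega_1_def trans_def by blast
  show "a \<le> b \<or> b \<le> a"
    using total refl Rep_omega_1 unfolding less_eq_omega_1_def total_on_def refl_on_def
    by (metis)
qed

end

instance omega_1 :: wellorder
proof
  fix P :: "omega_1 \<Rightarrow> bool" and a
  assume step: "\<And>x. (\<And>y. y < x \<Longrightarrow> P y) \<Longrightarrow> P x"
  have "wf (omega1 - Id)"
    using cardSuc_Well_order[OF natLeq_Card_order] by (simp add: well_order_on_def)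
  then have "wf (inv_image (omega1 - Id) Rep_omega_1)"
    by (rule wf_inv_image)
  moreover have "inv_image (omega1 - Id) Rep_omega_1 = {(x, y). x < y}"
    by (auto simp: inv_image_def less_omega_1_def less_eq_omega_1_def Rep_omega_1_inject)
  ultimately have "wf {(x, y :: omega_1). x < y}"
    by simp
  then show "P a"
    by (induction a rule: wf_induct_rule) (use step in auto)
qed

lemma card_of_UNIV_omega_1: "|UNIV :: omega_1 set| =o omega1"
proof -
  have "bij_betw Rep_omega_1 UNIV (Field omega1)"
    using type_definition.Rep_range[OF type_definition_omega_1]
    by (simp add: bij_betw_def inj_on_def Rep_omega_1_inject)
  then have "|UNIV :: omega_1 set| =o |Field omega1|"
    by (rule card_of_ordIsoI)
  moreover have "|Field omega1| =o omega1"
    by (rule card_of_Field_ordIso[OF cardSuc_Card_order[OF natLeq_Card_order]])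
  ultimately show ?thesis
    by (rule ordIso_transitive)
qed

lemma uncountable_UNIV_omega_1: "uncountable (UNIV :: omega_1 set)"
  unfolding uncountable_iff_omega1_ordLeq
  by (rule ordIso_imp_ordLeq[OF ordIso_symmetric[OF card_of_UNIV_omega_1]])

lemma countable_lessThan_omega_1: "countable {..< a :: omega_1}"
proof -
  have "Rep_omega_1 ` {..<a} \<subseteq> underS omega1 (Rep_omega_1 a)"
    by (auto simp: underS_def less_omega_1_def less_eq_omega_1_def Rep_omega_1_inject)
  then have le: "|{..<a}| \<le>o |underS omega1 (Rep_omega_1 a)|"
    by (intro card_of_ordLeqI[of Rep_omega_1]) (auto simp: inj_on_def Rep_omega_1_inject)
  have "|underS omega1 (Rep_omega_1 a)| <o omega1"
    by (rule card_of_underS[OF cardSuc_Card_order[OF natLeq_Card_order] Rep_omega_1])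
  with le have "|{..<a}| <o omega1"
    by (rule ordLeq_ordLess_trans)
  then have "\<not> omega1 \<le>o |{..<a}|"
    by (rule not_ordLess_ordLeq)
  then show ?thesis
    using uncountable_iff_omega1_ordLeq[of "{..<a}"] by simp
qed

lemma countable_atMost_omega_1: "countable {.. a :: omega_1}"
proof -
  have "{..a} = insert a {..<a}" by auto
  then show ?thesis by (simp add: countable_lessThan_omega_1)
qed

text \<open>The cofinality of \<open>\<omega>\<^sub>1\<close> is uncountable, because a countable union of countable initial
  segments is countable.\<close>

lemma countable_bounded_omega_1:
  fixes A :: "omega_1 set"
  assumes "countable A"
  obtains b where "\<And>a. a \<in> A \<Longrightarrow> a < b"
proof -
  have "countable (\<Union>a\<in>A. {..a})"
    by (intro countable_UN assms countable_atMost_omega_1)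
  then have "(\<Union>a\<in>A. {..a}) \<noteq> UNIV"
    using uncountable_UNIV_omega_1 by metis
  then obtain b where b: "b \<notin> (\<Union>a\<in>A. {..a})" by blast
  show thesis
  proof (rule that)
    fix a assume "a \<in> A"
    with b have "\<not> b \<le> a" by blast
    then show "a < b" by simp
  qed
qed

lemma uncountable_unbounded_omega_1:
  fixes A :: "omega_1 set"
  assumes "\<And>b. \<exists>a\<in>A. b \<le> a"
  shows "uncountable A"
proof
  assume "countable A"
  then obtain b where b: "\<And>a. a \<in> A \<Longrightarrow> a < b"
    using countable_bounded_omega_1[OF \<open>countable A\<close>] by blast
  obtain a where "a \<in> A" "b \<le> a"
    using assms by blast
  with b[of a] show False by simp
qed

text \<open>Transfinite recursion along \<open>\<omega>\<^sub>1\<close>: at every stage only countably many values have been chosen.\<close>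

lemma omega_1_dependent_choice:
  assumes "\<And>C. countable C \<Longrightarrow> \<exists>x. P C x"
  shows "\<exists>f :: omega_1 \<Rightarrow> 'a. \<forall>a. P (f ` {..<a}) (f a)"
proof (intro exI allI)
  define F :: "(omega_1 \<Rightarrow> 'a) \<Rightarrow> omega_1 \<Rightarrow> 'a" where "F f a = (SOME x. P (f ` {..<a}) x)" for f a
  define f where "f = wfrec {(a, b). a < b} F"
  have rec: "f a = F (cut f {(a, b). a < b} a) a" for a
    unfolding f_def by (rule wfrec) (rule wf)
  have cut: "cut f {(a, b). a < b} a ` {..<a} = f ` {..<a}" for a
    by (auto simp: cut_def)
  fix a
  have "\<exists>x. P (f ` {..<a}) x"
    by (intro assms countable_image countable_lessThan_omega_1)
  moreover have "f a = (SOME x. P (f ` {..<a}) x)"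
    using rec[of a] unfolding F_def cut .
  ultimately show "P (f ` {..<a}) (f a)"
    by (metis someI_ex)
qed

section \<open>Delta systems\<close>

text \<open>A maximal disjoint subfamily that is countable has a countable union, which every nonempty
  member of the family meets; so uncountably many members share a point of it.\<close>

lemma uncountable_disjoint_subfamily:
  assumes unc: "uncountable \<A>" and fin: "\<And>a. a \<in> \<A> \<Longrightarrow> finite a"
    and pt: "\<And>x. countable {a\<in>\<A>. x \<in> a}"
  obtains \<B> where "\<B> \<subseteq> \<A>" "uncountable \<B>" "pairwise disjnt \<B>"
proof -
  let ?D = "{\<B>. \<B> \<subseteq> \<A> \<and> pairwise disjnt \<B>}"
  have "\<exists>M\<in>?D. \<forall>N\<in>?D. M \<subseteq> N \<longrightarrow> N = M"
  proof (rule subset_Zorn')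
    fix C assume "subset.chain ?D C"
    then have C: "C \<subseteq> ?D" and ch: "\<And>A B. A \<in> C \<Longrightarrow> B \<in> C \<Longrightarrow> A \<subseteq> B \<or> B \<subseteq> A"
      by (auto simp: subset_chain_def)
    have "pairwise disjnt (\<Union>C)"
    proof (rule pairwiseI)
      fix a b assume "a \<in> \<Union>C" "b \<in> \<Union>C" "a \<noteq> b"
      then obtain A B where "A \<in> C" "B \<in> C" "a \<in> A" "b \<in> B" by auto
      with ch obtain D where "D \<in> C" "a \<in> D" "b \<in> D" by blast
      with \<open>a \<noteq> b\<close> show "disjnt a b" using C by (auto dest: pairwiseD)
    qed
    then show "\<Union>C \<in> ?D" using C by auto
  qed
  then obtain M where M: "M \<subseteq> \<A>" "pairwise disjnt M"
    and max: "\<And>N. N \<subseteq> \<A> \<Longrightarrow> pairwise disjnt N \<Longrightarrow> M \<subseteq> N \<Longrightarrow> N = M"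
    by auto
  have "uncountable M"
  proof
    assume "countable M"
    then have cU: "countable (\<Union>M)"
      using countable_UN[of M "\<lambda>a. a"] M(1) fin countable_finite by auto
    have "\<A> \<subseteq> insert {} (\<Union>x\<in>\<Union>M. {a\<in>\<A>. x \<in> a})"
    proof
      fix a assume a: "a \<in> \<A>"
      show "a \<in> insert {} (\<Union>x\<in>\<Union>M. {a\<in>\<A>. x \<in> a})"
      proof (cases "\<exists>b\<in>M. \<not> disjnt a b")
        case True
        then show ?thesis using a by (auto simp: disjnt_iff)
      next
        case False
        then have "pairwise disjnt (insert a M)"
          using M(2) by (auto simp: pairwise_insert disjnt_sym)
        then have "a \<in> M" using max[of "insert a M"] a M(1) by auto
        then have "disjnt a a" using False by auto
        then show ?thesis by simp
      qed
    qed
    moreover have "countable (insert {} (\<Union>x\<in>\<Union>M. {a\<in>\<A>. x \<in> a}))"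
      using cU pt by (intro countable_insert countable_UN)
    ultimately show False using unc countable_subset by blast
  qed
  with M(1) show thesis using M(2) by (rule that)
qed

text \<open>By induction on the common cardinality \<open>n\<close>: if some point lies in uncountably many members, it goes
  into the root and is removed from them; otherwise there is an uncountable disjoint subfamily.\<close>

lemma delta_system_card:
  assumes "uncountable \<A>" "\<And>a. a \<in> \<A> \<Longrightarrow> finite a \<and> card a = n"
  shows "\<exists>\<B> r. \<B> \<subseteq> \<A> \<and> uncountable \<B> \<and> (\<forall>a\<in>\<B>. \<forall>b\<in>\<B>. a \<noteq> b \<longrightarrow> a \<inter> b = r)"
  using assms
proof (induction n arbitrary: \<A>)
  case 0
  have "\<A> \<subseteq> {{}}"
  proof
    fix a assume "a \<in> \<A>"
    with 0(2)[of a] show "a \<in> {{}}" by auto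
  qed
  then have "countable \<A>" by (rule countable_subset) simp
  then show ?case using 0 by simp
next
  case (Suc n)
  show ?case
  proof (cases "\<forall>x. countable {a\<in>\<A>. x \<in> a}")
    case True
    then obtain \<B> where "\<B> \<subseteq> \<A>" "uncountable \<B>" "pairwise disjnt \<B>"
      using uncountable_disjoint_subfamily[OF Suc.prems(1)] Suc.prems(2) by metis
    then show ?thesis
      by (intro exI[of _ \<B>] exI[of _ "{}"]) (auto simp: pairwise_def disjnt_def)
  next
    case False
    then obtain x where x: "uncountable {a\<in>\<A>. x \<in> a}" by auto
    let ?A = "{a\<in>\<A>. x \<in> a}" and ?f = "\<lambda>a. a - {x}"
    have inj: "inj_on ?f ?A" by (auto simp: inj_on_def)
    have "uncountable (?f ` ?A)"
      using x inj countable_image_inj_on[of ?f ?A] by blast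
    moreover have "finite b \<and> card b = n" if "b \<in> ?f ` ?A" for b
      using that Suc.prems by auto
    ultimately have "\<exists>\<C> r. \<C> \<subseteq> ?f ` ?A \<and> uncountable \<C> \<and>
        (\<forall>a\<in>\<C>. \<forall>b\<in>\<C>. a \<noteq> b \<longrightarrow> a \<inter> b = r)"
      by (rule Suc.IH)
    then obtain \<C> r where C: "\<C> \<subseteq> ?f ` ?A" "uncountable \<C>"
      "\<forall>a\<in>\<C>. \<forall>b\<in>\<C>. a \<noteq> b \<longrightarrow> a \<inter> b = r"
      by (elim exE conjE) (rule that)
    let ?B = "insert x ` \<C>"
    have notin: "x \<notin> c" if "c \<in> \<C>" for c using C(1) that by auto
    then have "inj_on (insert x) \<C>"
      by (intro inj_onI) (simp add: insert_ident)
    then have "uncountable ?B" using C(2) countable_image_inj_on[of "insert x" \<C>] by blast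
    moreover have "?B \<subseteq> \<A>" using C(1) by (auto simp: insert_absorb)
    moreover have "\<forall>a\<in>?B. \<forall>b\<in>?B. a \<noteq> b \<longrightarrow> a \<inter> b = insert x r"
      using C(3) by auto
    ultimately show ?thesis
      by (intro exI[of _ ?B] exI[of _ "insert x r"] conjI)
  qed
qed

lemma delta_system:
  assumes unc: "uncountable \<A>" and fin: "\<And>a. a \<in> \<A> \<Longrightarrow> finite a"
  obtains \<B> r n where "\<B> \<subseteq> \<A>" "uncountable \<B>" "\<And>a. a \<in> \<B> \<Longrightarrow> card a = n"
    "\<And>a b. a \<in> \<B> \<Longrightarrow> b \<in> \<B> \<Longrightarrow> a \<noteq> b \<Longrightarrow> a \<inter> b = r"
proof -
  have "\<A> = (\<Union>n. {a\<in>\<A>. card a = n})" by auto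
  then obtain n where "uncountable {a\<in>\<A>. card a = n}"
    using unc countable_UN[of "UNIV :: nat set" "\<lambda>n. {a\<in>\<A>. card a = n}"] by fastforce
  then have "\<exists>\<B> r. \<B> \<subseteq> {a\<in>\<A>. card a = n} \<and> uncountable \<B> \<and>
      (\<forall>a\<in>\<B>. \<forall>b\<in>\<B>. a \<noteq> b \<longrightarrow> a \<inter> b = r)"
    by (rule delta_system_card) (simp add: fin)
  then obtain \<B> r where B: "\<B> \<subseteq> {a\<in>\<A>. card a = n}" "uncountable \<B>"
    "\<forall>a\<in>\<B>. \<forall>b\<in>\<B>. a \<noteq> b \<longrightarrow> a \<inter> b = r"
    by blast
  show thesis
  proof (rule that)
    show "\<B> \<subseteq> \<A>" using B(1) by blast
    show "uncountable \<B>" by (fact B(2))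
    show "card a = n" if "a \<in> \<B>" for a using B(1) that by blast
    show "a \<inter> b = r" if "a \<in> \<B>" "b \<in> \<B>" "a \<noteq> b" for a b using B(3) that by blast
  qed
qed

section \<open>Topological preliminaries\<close>

text \<open>Otherwise \<open>T\<close> is covered by open sets that each contain \<open>f i\<close> for only countably many indices, and a
  countable subcover would make \<open>I\<close> countable.  The indexed form spares the check that \<open>f\<close> is injective.\<close>

lemma Lindelof_condensation_point:
  assumes L: "Lindelof_space T" and f: "f \<in> I \<rightarrow> topspace T" and I: "uncountable I"
  obtains z where "z \<in> topspace T" "\<And>U. openin T U \<Longrightarrow> z \<in> U \<Longrightarrow> uncountable {i\<in>I. f i \<in> U}"
proof -
  have "\<exists>z\<in>topspace T. \<forall>U. openin T U \<and> z \<in> U \<longrightarrow> uncountable {i\<in>I. f i \<in> U}"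
  proof (rule ccontr)
    let ?U = "{U. openin T U \<and> countable {i\<in>I. f i \<in> U}}"
    assume "\<not> ?thesis"
    then have "\<And>z. z \<in> topspace T \<Longrightarrow> \<exists>U. openin T U \<and> z \<in> U \<and> countable {i\<in>I. f i \<in> U}"
      by blast
    then have "topspace T \<subseteq> \<Union>?U"
      by blast
    moreover have "\<Union>?U \<subseteq> topspace T"
      by (rule Union_least) (simp add: openin_subset)
    ultimately have "\<Union>?U = topspace T"
      by (intro equalityI)
    then have "\<exists>\<V>. countable \<V> \<and> \<V> \<subseteq> ?U \<and> \<Union>\<V> = topspace T"
      by (rule Lindelof_spaceD[OF L, rotated]) simp
    then obtain \<V> where "countable \<V> \<and> \<V> \<subseteq> ?U \<and> \<Union>\<V> = topspace T" ..
    then have V: "countable \<V>" "\<V> \<subseteq> ?U" "\<Union>\<V> = topspace T" by simp_all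
    have "I \<subseteq> (\<Union>U\<in>\<V>. {i\<in>I. f i \<in> U})"
    proof
      fix i assume i: "i \<in> I"
      with f have "f i \<in> \<Union>\<V>" unfolding V(3) by (rule funcset_mem)
      then obtain U where "U \<in> \<V>" "f i \<in> U" by (rule UnionE)
      with i show "i \<in> (\<Union>U\<in>\<V>. {i\<in>I. f i \<in> U})" by simp blast
    qed
    moreover have "countable (\<Union>U\<in>\<V>. {i\<in>I. f i \<in> U})"
      by (rule countable_UN[OF V(1)]) (use V(2) in blast)
    ultimately show False using I countable_subset by metis
  qed
  then obtain z where z: "z \<in> topspace T"
    "\<forall>U. openin T U \<and> z \<in> U \<longrightarrow> uncountable {i\<in>I. f i \<in> U}"
    by (elim bexE) (rule that)
  show thesis
    by (rule that[OF z(1)]) (use z(2) in simp)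
qed

lemma Lindelof_space_discrete_imp_countable:
  assumes "Lindelof_space (discrete_topology S)"
  shows "countable S"
proof (rule ccontr)
  assume unc: "uncountable S"
  show False
  proof (rule Lindelof_condensation_point[OF assms _ unc])
    show "id \<in> S \<rightarrow> topspace (discrete_topology S)" by auto
  next
    fix z
    assume "z \<in> topspace (discrete_topology S)"
      and "\<And>U. openin (discrete_topology S) U \<Longrightarrow> z \<in> U \<Longrightarrow> uncountable {i\<in>S. id i \<in> U}"
    from this(2)[of "{z}"] this(1) have "uncountable {i\<in>S. id i \<in> {z}}" by simp
    moreover have "{i\<in>S. id i \<in> {z}} \<subseteq> {z}" by auto
    ultimately show False by (metis countable_empty countable_insert countable_subset)
  qed
qed

lemma hereditarily_Lindelof_no_uncountable_discrete:
  assumes "hereditarily_Lindelof Z"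
  shows "\<not> has_uncountable_discrete_subspace Z"
  using assms Lindelof_space_discrete_imp_countable
  unfolding hereditarily_Lindelof_def has_uncountable_discrete_subspace_def by metis

text \<open>A countable subset of \<open>Y\<close> is never dense in \<open>Y\<close>, so the next point can always be chosen.\<close>

lemma nonseparable_left_separated:
  assumes Y: "Y \<subseteq> topspace X" "\<not> separable_space (subtopology X Y)"
  obtains y :: "omega_1 \<Rightarrow> 'a"
  where "\<And>a. y a \<in> Y" "\<And>a. y a \<notin> X closure_of (y ` {..<a})"
proof -
  have ex: "\<exists>x. x \<in> Y \<and> x \<notin> X closure_of C" if "countable C" "C \<subseteq> Y" for C
  proof (rule ccontr)
    assume "\<nexists>x. x \<in> Y \<and> x \<notin> X closure_of C"
    then have "subtopology X Y closure_of C = topspace (subtopology X Y)"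
      using that Y(1) by (auto simp: closure_of_subtopology Int_absorb1)
    moreover have "C \<subseteq> topspace (subtopology X Y)" using that Y(1) by auto
    ultimately show False using Y(2) that(1) unfolding separable_space_def by blast
  qed
  have "\<exists>x. C \<subseteq> Y \<longrightarrow> x \<in> Y \<and> x \<notin> X closure_of C" if "countable C" for C
    using ex[OF that] by blast
  then have "\<exists>y :: omega_1 \<Rightarrow> 'a. \<forall>a. y ` {..<a} \<subseteq> Y \<longrightarrow>
      y a \<in> Y \<and> y a \<notin> X closure_of (y ` {..<a})"
    by (rule omega_1_dependent_choice[where P = "\<lambda>C x. C \<subseteq> Y \<longrightarrow> x \<in> Y \<and> x \<notin> X closure_of C"])
  then obtain y :: "omega_1 \<Rightarrow> 'a"
    where y: "\<forall>a. y ` {..<a} \<subseteq> Y \<longrightarrow> y a \<in> Y \<and> y a \<notin> X closure_of (y ` {..<a})" ..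
  have "y a \<in> Y \<and> y a \<notin> X closure_of (y ` {..<a})" for a
  proof (induction a rule: less_induct)
    case (less a)
    then have "y ` {..<a} \<subseteq> Y" by auto
    with y show ?case by simp
  qed
  then show thesis by (intro that[of y]) blast+
qed

text \<open>A countable set of indices is bounded in \<open>\<omega>\<^sub>1\<close>.  Thus the union of the closures of the initial
  segments is closed.\<close>

lemma countably_tight_omega_1_sequence:
  fixes y :: "omega_1 \<Rightarrow> 'a"
  assumes "countably_tight X" "range y \<subseteq> topspace X" "x \<in> X closure_of range y"
  obtains c where "x \<in> X closure_of (y ` {..<c})"
proof -
  obtain B where B: "B \<subseteq> range y" "countable B" "x \<in> X closure_of B"
    using assms unfolding countably_tight_def by meson
  then have "\<exists>A. countable A \<and> A \<subseteq> UNIV \<and> B = y ` A"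
    using countable_subset_image[of B y UNIV] by simp
  then obtain A where A: "countable A" "B = y ` A" by blast
  obtain c where "\<And>a. a \<in> A \<Longrightarrow> a < c"
    using countable_bounded_omega_1[OF A(1)] by blast
  then have "B \<subseteq> y ` {..<c}" using A(2) by auto
  from closure_of_mono[OF this, of X] B(3) have "x \<in> X closure_of (y ` {..<c})" by blast
  then show thesis by (rule that)
qed

lemma nonseparable_separating_neighbourhoods:
  assumes reg: "regular_space X" and Y: "Y \<subseteq> topspace X" "\<not> separable_space (subtopology X Y)"
  obtains y :: "omega_1 \<Rightarrow> 'a" and U :: "omega_1 \<Rightarrow> 'a set"
  where "range y \<subseteq> Y" "inj y" "\<And>a. openin X (U a)" "\<And>a. y a \<in> U a"
    "\<And>a. X closure_of (U a) \<inter> X closure_of (y ` {..<a}) = {}"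
proof -
  obtain y :: "omega_1 \<Rightarrow> 'a" where yY: "\<And>a. y a \<in> Y"
    and sep: "\<And>a. y a \<notin> X closure_of (y ` {..<a})"
    using nonseparable_left_separated[OF Y] by metis
  have sub: "y ` A \<subseteq> topspace X" for A
    using yY Y(1) by blast
  have "y a \<noteq> y b" if "a < b" for a b
  proof -
    have "y a \<in> X closure_of (y ` {..<b})"
      using closure_of_subset[OF sub[of "{..<b}"]] that by blast
    then show ?thesis using sep[of b] by metis
  qed
  then have inj: "inj y" by (rule linorder_injI)
  have "\<exists>V. openin X V \<and> y a \<in> V \<and> X closure_of V \<inter> X closure_of (y ` {..<a}) = {}" for a
  proof -
    have "closedin X (X closure_of (y ` {..<a})) \<and> y a \<in> topspace X - X closure_of (y ` {..<a})"
      using sep[of a] sub[of "{a}"] by simp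
    then have "\<exists>V. openin X V \<and> y a \<in> V \<and> disjnt (X closure_of (y ` {..<a})) (X closure_of V)"
      using reg[unfolded regular_space] by blast
    then show ?thesis by (auto simp: disjnt_def Int_commute)
  qed
  then obtain U where U: "\<And>a. openin X (U a) \<and> y a \<in> U a \<and> X closure_of (U a) \<inter> X closure_of (y ` {..<a}) = {}"
    by metis
  show thesis
    by (rule that[OF _ inj, of U]) (use U yY in auto)
qed

lemma separated_family_discrete:
  assumes "inj y" "range y \<subseteq> Y" "Y \<subseteq> topspace X" "uncountable A"
    and U: "\<And>a. a \<in> A \<Longrightarrow> openin X (U a)" "\<And>a. a \<in> A \<Longrightarrow> y a \<in> U a"
    and sep: "\<And>a b. a \<in> A \<Longrightarrow> b \<in> A \<Longrightarrow> a \<noteq> b \<Longrightarrow> y a \<notin> U b"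
  shows "has_uncountable_discrete_subspace (subtopology X Y)"
  unfolding has_uncountable_discrete_subspace_def
proof (intro exI conjI)
  have AY: "y ` A \<subseteq> Y" using assms(2) by blast
  then show "y ` A \<subseteq> topspace (subtopology X Y)"
    using assms(3) by auto
  show "uncountable (y ` A)"
    using assms(4) countable_image_inj_on[of y A] inj_on_subset[OF assms(1)] by blast
  have eq: "subtopology (subtopology X Y) (y ` A) = subtopology X (y ` A)"
    using AY by (simp add: subtopology_subtopology Int_absorb1)
  have "openin (subtopology X (y ` A)) {y a}" if a: "a \<in> A" for a
  proof -
    have "{y a} = U a \<inter> y ` A"
      using a U(2)[OF a] sep[OF _ a] by blast
    then show ?thesis
      using U(1)[OF a] by (auto simp: openin_subtopology)
  qed
  moreover have "topspace (subtopology X (y ` A)) = y ` A"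
    using AY assms(3) by auto
  ultimately show "subtopology (subtopology X Y) (y ` A) = discrete_topology (y ` A)"
    unfolding eq by (metis (no_types, lifting) discrete_topology_unique imageE)
qed

section \<open>Posets and their transport along injections\<close>

text \<open>If no such \<open>p\<close> exists, each \<open>{x}\<close> has an extension \<open>q x\<close> all of whose further extensions stay below
  some \<open>h x\<close>.  Along a sequence \<open>f\<close> with \<open>h (f a) \<le> f b\<close> for \<open>a < b\<close>, the sets \<open>q (f a)\<close> are pairwise
  incompatible, because a common extension of \<open>q (f a)\<close> and \<open>q (f b)\<close> contains \<open>f b\<close>.\<close>

lemma ccc_omega_1_condition_forcing_unbounded:
  fixes \<Q> :: "omega_1 set set"
  assumes sing: "\<And>a. {a} \<in> \<Q>"
    and ccc: "\<And>\<A>. \<A> \<subseteq> \<Q> \<Longrightarrow> uncountable \<A> \<Longrightarrow> \<exists>p\<in>\<A>. \<exists>q\<in>\<A>. p \<noteq> q \<and> p \<union> q \<in> \<Q>"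
  shows "\<exists>p\<in>\<Q>. \<forall>q\<in>\<Q>. p \<subseteq> q \<longrightarrow> (\<forall>a. \<exists>s\<in>\<Q>. q \<subseteq> s \<and> (\<exists>b\<in>s. a \<le> b))"
proof (rule ccontr)
  assume no: "\<not> ?thesis"
  have "\<forall>x. \<exists>q a. q \<in> \<Q> \<and> x \<in> q \<and> (\<forall>s\<in>\<Q>. q \<subseteq> s \<longrightarrow> (\<forall>b\<in>s. b < a))"
  proof
    fix x
    have "\<not> (\<forall>q\<in>\<Q>. {x} \<subseteq> q \<longrightarrow> (\<forall>a. \<exists>s\<in>\<Q>. q \<subseteq> s \<and> (\<exists>b\<in>s. a \<le> b)))"
      using no sing[of x] by blast
    then obtain q a where "q \<in> \<Q>" "{x} \<subseteq> q" and *: "\<not> (\<exists>s\<in>\<Q>. q \<subseteq> s \<and> (\<exists>b\<in>s. a \<le> b))"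
      by blast
    moreover have "\<forall>s\<in>\<Q>. q \<subseteq> s \<longrightarrow> (\<forall>b\<in>s. b < a)"
      using * by (meson not_less)
    ultimately show "\<exists>q a. q \<in> \<Q> \<and> x \<in> q \<and> (\<forall>s\<in>\<Q>. q \<subseteq> s \<longrightarrow> (\<forall>b\<in>s. b < a))"
      by blast
  qed
  then obtain q h where q: "\<And>x. q x \<in> \<Q>" "\<And>x. x \<in> q x"
    and h: "\<And>x s b. s \<in> \<Q> \<Longrightarrow> q x \<subseteq> s \<Longrightarrow> b \<in> s \<Longrightarrow> b < h x"
    by metis
  have "\<exists>x. \<forall>c\<in>C. h c \<le> x" if C: "countable C" for C
  proof -
    obtain b where b: "\<And>a. a \<in> h ` C \<Longrightarrow> a < b"
      using countable_bounded_omega_1[OF countable_image[OF C, of h]] by blast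
    then have "\<forall>c\<in>C. h c \<le> b" by (simp add: less_imp_le)
    then show ?thesis ..
  qed
  then have "\<exists>f :: omega_1 \<Rightarrow> omega_1. \<forall>a. \<forall>c\<in>f ` {..<a}. h c \<le> f a"
    by (rule omega_1_dependent_choice[where P = "\<lambda>C x. \<forall>c\<in>C. h c \<le> x"])
  then obtain f :: "omega_1 \<Rightarrow> omega_1" where "\<forall>a. \<forall>c\<in>f ` {..<a}. h c \<le> f a" ..
  then have f: "h (f a) \<le> f b" if "a < b" for a b using that by simp
  have incompat: "q (f a) \<union> q (f b) \<notin> \<Q>" if "a < b" for a b
  proof
    assume "q (f a) \<union> q (f b) \<in> \<Q>"
    then have "f b < h (f a)"
      by (rule h) (use q(2) in auto)
    with f[OF that] show False by simp
  qed
  have neq: "q (f a) \<noteq> q (f b)" if "a < b" for a b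
    using incompat[OF that] q(1)[of "f a"] by auto
  have "inj (\<lambda>a. q (f a))"
    by (rule linorder_injI) (rule neq)
  then have "uncountable (range (\<lambda>a. q (f a)))"
    using uncountable_UNIV_omega_1 countable_image_inj_on[of "\<lambda>a. q (f a)" UNIV] by metis
  moreover have "range (\<lambda>a. q (f a)) \<subseteq> \<Q>"
    using q(1) by auto
  ultimately obtain p p' where "p \<in> range (\<lambda>a. q (f a))" "p' \<in> range (\<lambda>a. q (f a))"
    "p \<noteq> p'" "p \<union> p' \<in> \<Q>"
    using ccc by metis
  then obtain a b where ab: "q (f a) \<union> q (f b) \<in> \<Q>" "a \<noteq> b"
    by auto
  then consider "a < b" | "b < a" by fastforce
  then show False
    by cases (use ab incompat[of a b] incompat[of b a] in \<open>simp_all add: Un_commute\<close>)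
qed

text \<open>The sets \<open>D a\<close> decrease with \<open>a\<close>, and no element lies in all of them since \<open>g s\<close> is bounded.  A
  decreasing \<open>\<omega>\<^sub>1\<close>-sequence of nonempty sets with only countably many values is eventually constant,
  so its intersection would be nonempty.\<close>

lemma ordIso_omega1_decreasing_family:
  fixes D :: "omega_1 \<Rightarrow> 'b set set"
  assumes D: "\<And>a. D a = {s\<in>P. \<exists>b\<in>g s. a \<le> b}"
    and ne: "\<And>a. D a \<noteq> {}" and fin: "\<And>s. s \<in> P \<Longrightarrow> finite (g s :: omega_1 set)"
  shows "|range D| =o omega1"
proof -
  have "uncountable (range D)"
  proof
    assume "countable (range D)"
    then have "\<exists>A. countable A \<and> A \<subseteq> UNIV \<and> range D = D ` A"
      using countable_subset_image[of "range D" D UNIV] by simp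
    then obtain A where A: "countable A" "range D = D ` A" by blast
    obtain c where c: "\<And>a. a \<in> A \<Longrightarrow> a < c"
      using countable_bounded_omega_1[OF A(1)] by blast
    obtain s where s: "s \<in> D c" using ne by blast
    then have "finite (g s)" using D fin by simp
    then obtain d where d: "\<And>b. b \<in> g s \<Longrightarrow> b < d"
      using countable_bounded_omega_1[OF countable_finite] by blast
    have "D d \<in> D ` A" using A(2) by blast
    then obtain a where a: "a \<in> A" "D d = D a" by blast
    then have "s \<in> D a" using s c[of a] unfolding D by force
    then have "s \<in> D d" using a by simp
    then obtain b where "b \<in> g s" "d \<le> b" unfolding D by blast
    with d[of b] show False by simp
  qed
  then have "omega1 \<le>o |range D|"
    by (simp only: uncountable_iff_omega1_ordLeq)
  moreover have "|range D| \<le>o omega1"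
    by (rule ordLeq_ordIso_trans[OF card_of_image card_of_UNIV_omega_1])
  ultimately show ?thesis
    by (simp add: ordIso_iff_ordLeq)
qed

lemma map_prod_image_iff_inj:
  assumes "inj_on j P" "le \<subseteq> P \<times> P" "p \<in> P" "q \<in> P"
  shows "(j p, j q) \<in> map_prod j j ` le \<longleftrightarrow> (p, q) \<in> le"
proof
  assume "(j p, j q) \<in> map_prod j j ` le"
  then obtain p' q' where *: "(p', q') \<in> le" "j p = j p'" "j q = j q'"
    by blast
  then have "p' \<in> P" "q' \<in> P"
    using assms(2) by blast+
  then have "p = p'" "q = q'"
    using * assms inj_onD by metis+
  with * show "(p, q) \<in> le" by simp
next
  assume "(p, q) \<in> le"
  then show "(j p, j q) \<in> map_prod j j ` le"
    by (metis map_prod_imageI)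
qed

lemma ccc_poset_inj_image:
  assumes inj: "inj_on j P" and ccc: "ccc_poset P le"
  shows "ccc_poset (j ` P) (map_prod j j ` le)"
proof -
  have po: "partial_order_on P le" and ne: "P \<noteq> {}"
    and anti: "\<And>A. A \<subseteq> P \<Longrightarrow> (\<forall>p\<in>A. \<forall>q\<in>A. p \<noteq> q \<longrightarrow> \<not> compatible_in P le p q) \<Longrightarrow> countable A"
    using ccc by (simp_all add: ccc_poset_def)
  have sub: "le \<subseteq> P \<times> P" and refl: "refl_on P le" and trans: "trans le" and antisym: "antisym le"
    using po by (auto simp: partial_order_on_def preorder_on_def)
  have mem: "(j p, j q) \<in> map_prod j j ` le \<longleftrightarrow> (p, q) \<in> le" if "p \<in> P" "q \<in> P" for p q
    by (rule map_prod_image_iff_inj[OF inj sub that])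
  have "map_prod j j ` le \<subseteq> j ` P \<times> j ` P"
    using sub by auto
  moreover have "refl_on (j ` P) (map_prod j j ` le)"
    unfolding refl_on_def using refl by (auto simp: refl_on_def)
  moreover have "trans (map_prod j j ` le)"
  proof (rule transI)
    fix x y z assume *: "(x, y) \<in> map_prod j j ` le" "(y, z) \<in> map_prod j j ` le"
    then obtain p q r where pqr: "p \<in> P" "q \<in> P" "r \<in> P" "x = j p" "y = j q" "z = j r"
      using sub by blast
    then have "(p, q) \<in> le" "(q, r) \<in> le"
      using * mem by simp_all
    then have "(p, r) \<in> le" by (rule transD[OF trans])
    with pqr mem show "(x, z) \<in> map_prod j j ` le" by simp
  qed
  moreover have "antisym (map_prod j j ` le)"
  proof (rule antisymI)
    fix x y assume "(x, y) \<in> map_prod j j ` le" "(y, x) \<in> map_prod j j ` le"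
    then obtain p q where pq: "p \<in> P" "q \<in> P" "x = j p" "y = j q"
      using sub by blast
    then show "x = y"
      using mem[of p q] mem[of q p] antisymD[OF antisym, of p q]
        \<open>(x, y) \<in> map_prod j j ` le\<close> \<open>(y, x) \<in> map_prod j j ` le\<close> by simp
  qed
  moreover have "countable A"
    if A: "A \<subseteq> j ` P" "\<forall>x\<in>A. \<forall>y\<in>A. x \<noteq> y \<longrightarrow> \<not> compatible_in (j ` P) (map_prod j j ` le) x y" for A
  proof -
    obtain B where B: "B \<subseteq> P" "A = j ` B"
      using A(1) by (auto simp: subset_image_iff)
    have "\<not> compatible_in P le p q" if pq: "p \<in> B" "q \<in> B" "p \<noteq> q" for p q
    proof
      assume "compatible_in P le p q"
      then obtain s where s: "s \<in> P" "(s, p) \<in> le" "(s, q) \<in> le"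
        by (auto simp: compatible_in_def)
      have P: "p \<in> P" "q \<in> P" using pq B(1) by auto
      have "compatible_in (j ` P) (map_prod j j ` le) (j p) (j q)"
        unfolding compatible_in_def
        by (rule bexI[of _ "j s"]) (simp_all add: s mem P)
      moreover have "j p \<noteq> j q"
        using inj_onD[OF inj _ P] pq(3) by blast
      moreover have "j p \<in> A" "j q \<in> A"
        using B(2) pq by simp_all
      ultimately show False using A(2) by simp
    qed
    then have "countable B" by (intro anti[OF B(1)]) simp
    then show ?thesis using B(2) by simp
  qed
  ultimately show ?thesis
    using ne unfolding ccc_poset_def partial_order_on_def preorder_on_def by simp
qed

lemma dense_in_poset_image:
  assumes "dense_in_poset P le D"
  shows "dense_in_poset (j ` P) (map_prod j j ` le) (j ` D)"
  unfolding dense_in_poset_def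
proof (intro conjI ballI)
  show "j ` D \<subseteq> j ` P"
    using assms by (intro image_mono) (simp add: dense_in_poset_def)
  fix x assume "x \<in> j ` P"
  then obtain p where "p \<in> P" "x = j p" by blast
  then obtain d where "d \<in> D" "(d, p) \<in> le"
    using assms unfolding dense_in_poset_def by blast
  then show "\<exists>d\<in>j ` D. (d, x) \<in> map_prod j j ` le"
    using \<open>x = j p\<close> by (metis image_eqI map_prod_imageI)
qed

lemma filter_in_poset_inj_vimage:
  assumes inj: "inj_on j P" and le: "le \<subseteq> P \<times> P"
    and G: "filter_in_poset (j ` P) (map_prod j j ` le) G"
  shows "filter_in_poset P le {p\<in>P. j p \<in> G}"
proof -
  have mem: "(j p, j q) \<in> map_prod j j ` le \<longleftrightarrow> (p, q) \<in> le" if "p \<in> P" "q \<in> P" for p q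
    by (rule map_prod_image_iff_inj[OF inj le that])
  have sub: "G \<subseteq> j ` P" and ne: "G \<noteq> {}"
    and up: "\<forall>x\<in>G. \<forall>y\<in>j ` P. (x, y) \<in> map_prod j j ` le \<longrightarrow> y \<in> G"
    and dir: "\<forall>x\<in>G. \<forall>y\<in>G. \<exists>z\<in>G. (z, x) \<in> map_prod j j ` le \<and> (z, y) \<in> map_prod j j ` le"
    using G unfolding filter_in_poset_def by - (elim conjE, assumption)+
  show ?thesis
    unfolding filter_in_poset_def
  proof (intro conjI ballI impI)
    show "{p\<in>P. j p \<in> G} \<noteq> {}" using sub ne by blast
  next
    fix p q assume "p \<in> {p\<in>P. j p \<in> G}" "q \<in> P" "(p, q) \<in> le"
    then show "q \<in> {p\<in>P. j p \<in> G}"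
      using bspec[OF bspec[OF up, of "j p"], of "j q"] mem[of p q] by simp
  next
    fix p q assume pq: "p \<in> {p\<in>P. j p \<in> G}" "q \<in> {p\<in>P. j p \<in> G}"
    then have "\<exists>z\<in>G. (z, j p) \<in> map_prod j j ` le \<and> (z, j q) \<in> map_prod j j ` le"
      using bspec[OF bspec[OF dir, of "j p"], of "j q"] by simp
    then obtain z where z: "z \<in> G" "(z, j p) \<in> map_prod j j ` le" "(z, j q) \<in> map_prod j j ` le"
      by (elim bexE conjE) (rule that)
    then obtain s where s: "s \<in> P" "z = j s" using sub by auto
    then have "s \<in> {p\<in>P. j p \<in> G}" "(s, p) \<in> le" "(s, q) \<in> le"
      using z mem pq by auto
    then show "\<exists>r\<in>{p\<in>P. j p \<in> G}. (r, p) \<in> le \<and> (r, q) \<in> le" by blast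
  qed auto
qed

text \<open>A set with \<open>n + 1\<close> elements arises by inserting a point into a set with \<open>n\<close> elements, and
  \<open>\<kappa> \<cdot> \<kappa> = \<kappa>\<close> for infinite \<open>\<kappa>\<close>.\<close>

lemma card_of_finite_subsets_infinite:
  assumes inf: "infinite (UNIV :: 'b set)"
  shows "|{p :: 'b set. finite p}| \<le>o |UNIV :: 'b set|"
proof -
  let ?F = "\<lambda>n. {p :: 'b set. finite p \<and> card p = n}"
  have step: "|?F n| \<le>o |UNIV :: 'b set|" for n
  proof (induction n)
    case 0
    have "?F 0 \<subseteq> (\<lambda>_. {}) ` (UNIV :: 'b set)" by auto
    then have "|?F 0| \<le>o |(\<lambda>_. {} :: 'b set) ` (UNIV :: 'b set)|" by (rule card_of_mono1)
    also have "|(\<lambda>_. {} :: 'b set) ` (UNIV :: 'b set)| \<le>o |UNIV :: 'b set|" by (rule card_of_image)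
    finally show ?case .
  next
    case (Suc n)
    let ?i = "\<lambda>(x :: 'b, p). insert x p"
    have "?F (Suc n) \<subseteq> ?i ` (UNIV \<times> ?F n)"
    proof
      fix p assume p: "p \<in> ?F (Suc n)"
      then obtain x where "x \<in> p" by fastforce
      then have "p = ?i (x, p - {x})" "p - {x} \<in> ?F n"
        using p by auto
      then show "p \<in> ?i ` (UNIV \<times> ?F n)" by blast
    qed
    then have "|?F (Suc n)| \<le>o |?i ` (UNIV \<times> ?F n)|" by (rule card_of_mono1)
    moreover have "|?i ` (UNIV \<times> ?F n)| \<le>o |(UNIV :: 'b set) \<times> ?F n|" by (rule card_of_image)
    moreover have "|(UNIV :: 'b set) \<times> ?F n| \<le>o |UNIV :: 'b set|"
      by (rule card_of_Times_ordLeq_infinite_Field[OF _ ordLeq_refl[OF card_of_Card_order]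
            Suc.IH card_of_Card_order]) (simp add: Field_card_of inf)
    ultimately show ?case
      by (rule ordLeq_transitive[OF ordLeq_transitive])
  qed
  have "|UNIV :: nat set| \<le>o |UNIV :: 'b set|"
    using inf by (simp only: infinite_iff_card_of_nat)
  then have "|\<Union>n. ?F n| \<le>o |UNIV :: 'b set|"
    by (rule card_of_UNION_ordLeq_infinite[OF inf]) (use step in blast)
  moreover have "(\<Union>n. ?F n) = {p. finite p}" by auto
  ultimately show ?thesis by (simp only:)
qed

lemma finite_sets_omega_1_embed:
  assumes "uncountable (UNIV :: 'p set)"
  obtains j :: "omega_1 set \<Rightarrow> 'p" where "inj_on j {p. finite p}"
proof -
  have "infinite (UNIV :: omega_1 set)"
    using uncountable_UNIV_omega_1 countable_finite by blast
  then have "|{p :: omega_1 set. finite p}| \<le>o |UNIV :: omega_1 set|"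
    by (rule card_of_finite_subsets_infinite)
  then have "|{p :: omega_1 set. finite p}| \<le>o omega1"
    by (rule ordLeq_ordIso_trans[OF _ card_of_UNIV_omega_1])
  moreover have "omega1 \<le>o |UNIV :: 'p set|"
    using assms by (simp only: uncountable_iff_omega1_ordLeq)
  ultimately have "|{p :: omega_1 set. finite p}| \<le>o |UNIV :: 'p set|"
    by (rule ordLeq_transitive)
  then have "\<exists>j. inj_on j {p :: omega_1 set. finite p} \<and> j ` {p. finite p} \<subseteq> (UNIV :: 'p set)"
    by (simp only: card_of_ordLeq)
  then show thesis
    using that by blast
qed

section \<open>Finite sets of indices that separate the points of a sequence\<close>

definition separation_conditions :: "(omega_1 \<Rightarrow> 'a) \<Rightarrow> (omega_1 \<Rightarrow> 'a set) \<Rightarrow> omega_1 set set" where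
  "separation_conditions y U = {p. finite p \<and> (\<forall>a\<in>p. \<forall>b\<in>p. a \<noteq> b \<longrightarrow> y a \<notin> U b)}"

text \<open>Coordinate projections of a power are continuous.\<close>

lemma closure_of_power_projection:
  assumes z: "z \<in> topspace (power_topology X m)" "j < m"
    and dense: "\<And>N. openin (power_topology X m) N \<Longrightarrow> z \<in> N \<Longrightarrow> \<exists>x\<in>N. x j \<in> S"
  shows "z j \<in> X closure_of S"
  unfolding in_closure_of
proof (intro conjI allI impI)
  show "z j \<in> topspace X"
    using z by (auto simp: power_topology_def)
  fix T assume T: "z j \<in> T \<and> openin X T"
  let ?N = "{x \<in> topspace (power_topology X m). x j \<in> T}"
  have "continuous_map (power_topology X m) X (\<lambda>x. x j)"
    unfolding power_topology_def using z(2) by (intro continuous_map_product_projection) simp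
  then have "openin (power_topology X m) ?N"
    by (rule openin_continuous_map_preimage) (use T in simp)
  from dense[OF this] z(1) T show "\<exists>x. x \<in> S \<and> x \<in> T" by auto
qed

lemma common_threshold:
  fixes P :: "nat \<Rightarrow> 'b :: linorder \<Rightarrow> bool"
  assumes "\<And>j. j < m \<Longrightarrow> \<exists>c. P j c" and mono: "\<And>j c d. P j c \<Longrightarrow> c \<le> d \<Longrightarrow> P j d"
  shows "\<exists>c. \<forall>j<m. P j c"
  using assms(1)
proof (induction m)
  case (Suc m)
  then obtain c where c: "\<forall>j<m. P j c" by auto
  obtain d where d: "P m d" using Suc.prems by blast
  have "\<forall>j<Suc m. P j (max c d)"
    using c d mono by (metis less_Suc_eq max.cobounded1 max.cobounded2)
  then show ?case ..
qed simp

text \<open>Off the root \<open>r\<close> each point belongs to at most one member of the family.\<close>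

lemma countable_disjoint_meets_countable:
  assumes disj: "\<And>p q. p \<in> \<B> \<Longrightarrow> q \<in> \<B> \<Longrightarrow> p \<noteq> q \<Longrightarrow> p \<inter> q \<subseteq> r" and "countable C"
  shows "countable {p\<in>\<B>. (p - r) \<inter> C \<noteq> {}}"
proof -
  have "{p\<in>\<B>. (p - r) \<inter> C \<noteq> {}} = (\<Union>a\<in>C. {p\<in>\<B>. a \<in> p - r})"
    by auto
  moreover have "countable {p\<in>\<B>. a \<in> p - r}" for a
  proof (cases "\<exists>p\<in>\<B>. a \<in> p - r")
    case True
    then obtain p where p: "p \<in> \<B>" "a \<in> p - r" by blast
    have "{p\<in>\<B>. a \<in> p - r} \<subseteq> {p}"
    proof
      fix q assume "q \<in> {p\<in>\<B>. a \<in> p - r}"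
      then show "q \<in> {p}" using disj[of p q] p by auto
    qed
    then show ?thesis by (rule countable_subset) simp
  next
    case False
    then have "{p\<in>\<B>. a \<in> p - r} = {}" by blast
    then show ?thesis by (simp only: countable_empty)
  qed
  ultimately show ?thesis
    using \<open>countable C\<close> by simp
qed

text \<open>If \<open>a\<close> and \<open>b\<close> both lie in \<open>p\<close> or both in \<open>q\<close>, they cannot be in conflict in \<open>p \<union> q\<close>; this settles all pairs
  involving the root.  If \<open>a < b\<close>, then \<open>y a \<notin> U b\<close> holds by the choice of \<open>U\<close>.  Only \<open>y a \<notin> U b\<close>
  for \<open>b < a\<close>, with \<open>b\<close> in \<open>p\<close> and \<open>a\<close> in \<open>q\<close> off the root, has to be arranged, and this is what the
  condensation point achieves.\<close>

lemma separation_conditions_ccc: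
  fixes y :: "omega_1 \<Rightarrow> 'a" and U :: "omega_1 \<Rightarrow> 'a set"
  assumes tight: "countably_tight X"
    and Lind: "\<And>n. Lindelof_space (power_topology X n)"
    and y: "range y \<subseteq> topspace X" and U: "\<And>a. U a \<subseteq> topspace X"
    and disj: "\<And>a. X closure_of (U a) \<inter> X closure_of (y ` {..<a}) = {}"
    and \<A>: "\<A> \<subseteq> separation_conditions y U" "uncountable \<A>"
  shows "\<exists>p\<in>\<A>. \<exists>q\<in>\<A>. p \<noteq> q \<and> p \<union> q \<in> separation_conditions y U"
proof -
  have fin: "finite p" if "p \<in> \<A>" for p
    using that \<A>(1) by (auto simp: separation_conditions_def)
  obtain \<B> r n where \<B>: "\<B> \<subseteq> \<A>" "uncountable \<B>" and card: "\<And>p. p \<in> \<B> \<Longrightarrow> card p = n"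
    and delta: "\<And>p q. p \<in> \<B> \<Longrightarrow> q \<in> \<B> \<Longrightarrow> p \<noteq> q \<Longrightarrow> p \<inter> q = r"
    using delta_system[OF \<A>(2) fin] by metis
  have root: "r \<subseteq> p" if p: "p \<in> \<B>" for p
  proof -
    have "\<not> \<B> \<subseteq> {p}"
      using \<B>(2) countable_subset[of \<B> "{p}"] by auto
    then obtain q where "q \<in> \<B>" "q \<noteq> p" by blast
    then show ?thesis using delta[OF p] by blast
  qed
  define m where "m = n - card r"
  define e where "e p = sorted_list_of_set (p - r)" for p :: "omega_1 set"
  \<comment> \<open>The point of \<open>X\<^sup>m\<close> that lists the elements of \<open>p\<close> off the root in increasing order.\<close>
  define x where "x p = (\<lambda>j\<in>{..<m}. y (e p ! j))" for p
  have finB: "finite p" if "p \<in> \<B>" for p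
    using fin \<B>(1) that by blast
  have len: "length (e p) = m" and set: "set (e p) = p - r" if p: "p \<in> \<B>" for p
    using card[OF p] finB[OF p] root[OF p]
    by (simp_all add: e_def m_def card_Diff_subset finite_subset)
  have x_top: "x \<in> \<B> \<rightarrow> topspace (power_topology X m)"
    unfolding x_def power_topology_def topspace_product_topology
    by (intro Pi_I restrict_PiE_iff[THEN iffD2] ballI) (use y in blast)
  obtain z where z: "z \<in> topspace (power_topology X m)"
    and cond: "\<And>N. openin (power_topology X m) N \<Longrightarrow> z \<in> N \<Longrightarrow> uncountable {p\<in>\<B>. x p \<in> N}"
    using Lindelof_condensation_point[OF Lind x_top \<B>(2)] by metis
  have "\<exists>c. z j \<in> X closure_of (y ` {..<c})" if j: "j < m" for j
  proof -
    have "z j \<in> X closure_of range y"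
    proof (rule closure_of_power_projection[OF z j])
      fix N assume "openin (power_topology X m) N" "z \<in> N"
      then have "uncountable {p\<in>\<B>. x p \<in> N}" by (rule cond)
      then have "{p\<in>\<B>. x p \<in> N} \<noteq> {}" by (metis countable_empty)
      then obtain p where "x p \<in> N" by blast
      moreover have "x p j \<in> range y" using j by (simp add: x_def)
      ultimately show "\<exists>v\<in>N. v j \<in> range y" by blast
    qed
    then show ?thesis
      using countably_tight_omega_1_sequence[OF tight y] by metis
  qed
  then have "\<exists>c. \<forall>j<m. z j \<in> X closure_of (y ` {..<c})"
  proof (rule common_threshold)
    fix j and c d :: omega_1
    assume "z j \<in> X closure_of (y ` {..<c})" "c \<le> d"
    moreover have "X closure_of (y ` {..<c}) \<subseteq> X closure_of (y ` {..<d})"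
      using \<open>c \<le> d\<close> by (intro closure_of_mono image_mono) auto
    ultimately show "z j \<in> X closure_of (y ` {..<d})" by blast
  qed
  then obtain c where c: "\<And>j. j < m \<Longrightarrow> z j \<in> X closure_of (y ` {..<c})" by blast
  have few: "countable {p\<in>\<B>. (p - r) \<inter> {..<b} \<noteq> {}}" for b
    by (rule countable_disjoint_meets_countable) (use delta countable_lessThan_omega_1 in auto)
  have "\<not> \<B> \<subseteq> {p\<in>\<B>. (p - r) \<inter> {..<c} \<noteq> {}}"
    using \<B>(2) countable_subset[OF _ few] by blast
  then obtain p where p: "p \<in> \<B>" "(p - r) \<inter> {..<c} = {}" by blast
  define W where "W = topspace X - (\<Union>a\<in>p - r. X closure_of (U a))"
  \<comment> \<open>\<open>N\<close> is a neighbourhood of \<open>z\<close> that keeps every coordinate away from all \<open>U a\<close> with \<open>a \<in> p - r\<close>.\<close>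
  define N where "N = (\<Pi>\<^sub>E j\<in>{..<m}. W)"
  have "openin X W"
    unfolding W_def using finB[OF p(1)] by (intro openin_diff closedin_Union) auto
  then have "openin (power_topology X m) N"
    unfolding N_def power_topology_def by (simp add: openin_PiE_gen)
  moreover have "z \<in> N"
  proof -
    have "z j \<in> W" if j: "j < m" for j
    proof -
      have "z j \<notin> X closure_of (U a)" if a: "a \<in> p - r" for a
      proof -
        have "c \<le> a" using p(2) a by (meson IntI disjoint_iff lessThan_iff not_less)
        then have "X closure_of (y ` {..<c}) \<subseteq> X closure_of (y ` {..<a})"
          by (intro closure_of_mono image_mono) auto
        then show ?thesis using c[OF j] disj[of a] by blast
      qed
      moreover have "z j \<in> topspace X"
        using z j by (auto simp: power_topology_def)
      ultimately show ?thesis by (simp add: W_def)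
    qed
    then show ?thesis
      using z by (auto simp: N_def power_topology_def PiE_iff)
  qed
  ultimately have unc: "uncountable {q\<in>\<B>. x q \<in> N}"
    by (rule cond)
  obtain d where d: "\<And>a. a \<in> p \<Longrightarrow> a < d"
    using countable_bounded_omega_1[OF countable_finite[OF finB[OF p(1)]]] by blast
  have "\<exists>q\<in>\<B>. x q \<in> N \<and> q \<noteq> p \<and> (q - r) \<inter> {..<d} = {}"
  proof (rule ccontr)
    assume no: "\<not> ?thesis"
    have "{q\<in>\<B>. x q \<in> N} \<subseteq> insert p {q\<in>\<B>. (q - r) \<inter> {..<d} \<noteq> {}}"
      using no by (intro subsetI) simp
    then have "countable {q\<in>\<B>. x q \<in> N}"
      by (rule countable_subset[OF _ countable_insert[OF few]])
    with unc show False by (rule notE)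
  qed
  then obtain q where q: "q \<in> \<B>" "x q \<in> N" "q \<noteq> p" "(q - r) \<inter> {..<d} = {}"
    by (elim bexE conjE) (rule that)
  have cl: "U b \<subseteq> X closure_of (U b)" for b
    using U by (rule closure_of_subset)
  have below: "y a \<notin> U b" if "a < b" for a b
  proof -
    have "y ` {..<b} \<subseteq> X closure_of (y ` {..<b})"
      using y by (intro closure_of_subset) auto
    then have "y a \<in> X closure_of (y ` {..<b})" using that by auto
    then show ?thesis using disj[of b] cl[of b] by blast
  qed
  have pq: "p \<in> separation_conditions y U" "q \<in> separation_conditions y U"
    using p(1) q(1) \<B>(1) \<A>(1) by blast+
  have new_old: "y a \<notin> U b" if ab: "a \<in> q - r" "b \<in> p - r" for a b
  proof -
    obtain j where "j < m" "a = e q ! j"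
      using ab(1) set[OF q(1)] len[OF q(1)] by (metis in_set_conv_nth)
    then have "y a \<in> W" using q(2) by (auto simp: N_def x_def PiE_iff)
    then show ?thesis using ab(2) cl[of b] by (auto simp: W_def)
  qed
  have old_new: "y a \<notin> U b" if ab: "a \<in> p" "b \<in> q - r" for a b
  proof (rule below)
    have "d \<le> b" using q(4) ab(2) by (meson IntI disjoint_iff lessThan_iff not_less)
    then show "a < b" using d[OF ab(1)] by simp
  qed
  have "y a \<notin> U b" if ab: "a \<in> p \<union> q" "b \<in> p \<union> q" "a \<noteq> b" for a b
  proof -
    consider "a \<in> p" "b \<in> p" | "a \<in> q" "b \<in> q" | "a \<in> q - r" "b \<in> p - r" | "a \<in> p" "b \<in> q - r"
      using ab(1,2) root[OF p(1)] root[OF q(1)] by blast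
    then show ?thesis
      using pq ab(3) new_old old_new by cases (auto simp: separation_conditions_def)
  qed
  then have "p \<union> q \<in> separation_conditions y U"
    using pq by (simp add: separation_conditions_def)
  then show ?thesis using p(1) q(1,3) \<B>(1) by blast
qed

section \<open>The forcing theorem\<close>

text \<open>The conditions are those extending a \<open>p0\<close> that forces the generic set of indices to be unbounded.  A
  filter that meets every \<open>D a\<close> has an uncountable union, and any two indices in this union lie in a
  single condition, so they satisfy \<open>y a \<notin> U b\<close>.\<close>

lemma ccc_poset_forcing_uncountable_discrete:
  fixes X :: "'a topology"
  assumes unc: "uncountable (UNIV :: 'p set)"
    and reg: "regular_space X" and tight: "countably_tight X"
    and Y: "Y \<subseteq> topspace X" "\<not> separable_space (subtopology X Y)"
    and Lind: "\<And>n. Lindelof_space (power_topology X n)"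
  shows "\<exists>(P :: 'p set) le \<D>.
    ccc_poset P le \<and> (\<forall>D\<in>\<D>. dense_in_poset P le D) \<and> |\<D>| =o omega1 \<and>
    ((\<exists>G. filter_in_poset P le G \<and> (\<forall>D\<in>\<D>. G \<inter> D \<noteq> {})) \<longrightarrow>
      has_uncountable_discrete_subspace (subtopology X Y))"
proof -
  obtain y :: "omega_1 \<Rightarrow> 'a" and U :: "omega_1 \<Rightarrow> 'a set"
    where y: "range y \<subseteq> Y" "inj y" and U: "\<And>a. openin X (U a)" "\<And>a. y a \<in> U a"
      and disj: "\<And>a. X closure_of (U a) \<inter> X closure_of (y ` {..<a}) = {}"
    using nonseparable_separating_neighbourhoods[OF reg Y] by metis
  define \<Q> where "\<Q> = separation_conditions y U"
  have fin: "finite s" if "s \<in> \<Q>" for s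
    using that by (simp add: \<Q>_def separation_conditions_def)
  have sing: "{a} \<in> \<Q>" for a
    by (simp add: \<Q>_def separation_conditions_def)
  have yX: "range y \<subseteq> topspace X" using y(1) Y(1) by blast
  have ccc: "\<exists>p\<in>\<A>. \<exists>q\<in>\<A>. p \<noteq> q \<and> p \<union> q \<in> \<Q>" if "\<A> \<subseteq> \<Q>" "uncountable \<A>" for \<A>
    unfolding \<Q>_def
    using separation_conditions_ccc[OF tight Lind yX openin_subset[OF U(1)] disj] that
    unfolding \<Q>_def by blast
  have "\<exists>p\<in>\<Q>. \<forall>q\<in>\<Q>. p \<subseteq> q \<longrightarrow> (\<forall>a. \<exists>s\<in>\<Q>. q \<subseteq> s \<and> (\<exists>b\<in>s. a \<le> b))"
    by (rule ccc_omega_1_condition_forcing_unbounded[OF sing ccc])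
  then obtain p0 where p0: "p0 \<in> \<Q>"
    and ext: "\<forall>q\<in>\<Q>. p0 \<subseteq> q \<longrightarrow> (\<forall>a. \<exists>s\<in>\<Q>. q \<subseteq> s \<and> (\<exists>b\<in>s. a \<le> b))"
    by (elim bexE) (rule that)
  define P where "P = {s\<in>\<Q>. p0 \<subseteq> s}"
  define le where "le = {(s, q). s \<in> P \<and> q \<in> P \<and> q \<subseteq> s}"
  define D where "D a = {s\<in>P. \<exists>b\<in>s. a \<le> b}" for a
  have leP: "le \<subseteq> P \<times> P" by (auto simp: le_def)
  have "partial_order_on P le"
    unfolding partial_order_on_def preorder_on_def
    by (auto simp: le_def refl_on_def trans_def antisym_def)
  moreover have "countable A"
    if A: "A \<subseteq> P" "\<forall>p\<in>A. \<forall>q\<in>A. p \<noteq> q \<longrightarrow> \<not> compatible_in P le p q" for A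
  proof (rule ccontr)
    assume "uncountable A"
    moreover have "A \<subseteq> \<Q>" using A(1) by (auto simp: P_def)
    ultimately obtain p q where pq: "p \<in> A" "q \<in> A" "p \<noteq> q" "p \<union> q \<in> \<Q>"
      using ccc by metis
    have P: "p \<in> P" "q \<in> P" using pq A(1) by blast+
    then have "p \<union> q \<in> P" using pq(4) by (auto simp: P_def)
    then have "compatible_in P le p q"
      unfolding compatible_in_def by (intro bexI[of _ "p \<union> q"]) (use P in \<open>simp_all add: le_def\<close>)
    then show False using A(2) pq by simp
  qed
  moreover have "p0 \<in> P" using p0 by (simp add: P_def)
  ultimately have cccP: "ccc_poset P le"
    unfolding ccc_poset_def by (intro conjI allI impI) auto
  have dense: "dense_in_poset P le (D a)" for a
    unfolding dense_in_poset_def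
  proof (intro conjI ballI)
    show "D a \<subseteq> P" by (auto simp: D_def)
    fix q assume q: "q \<in> P"
    then have "\<exists>s\<in>\<Q>. q \<subseteq> s \<and> (\<exists>b\<in>s. a \<le> b)"
      using ext by (simp add: P_def)
    then obtain s where s: "s \<in> \<Q>" "q \<subseteq> s" "\<exists>b\<in>s. a \<le> b"
      by (elim bexE conjE) (rule that; blast)
    have sP: "s \<in> P" using s q by (auto simp: P_def)
    then have "s \<in> D a" "(s, q) \<in> le"
      using s q by (simp_all add: D_def le_def)
    then show "\<exists>d\<in>D a. (d, q) \<in> le" ..
  qed
  have Dne: "D a \<noteq> {}" for a
    using dense[of a] \<open>p0 \<in> P\<close> unfolding dense_in_poset_def by blast
  have finP: "finite s" if "s \<in> P" for s
    using fin that by (simp add: P_def)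
  have cardD: "|range D| =o omega1"
    by (rule ordIso_omega1_decreasing_family[OF D_def Dne finP])
  obtain j :: "omega_1 set \<Rightarrow> 'p" where "inj_on j {p. finite p}"
    using finite_sets_omega_1_embed[OF unc] by metis
  then have j: "inj_on j P"
    by (rule inj_on_subset) (use finP in blast)
  define \<D> where "\<D> = (\<lambda>E. j ` E) ` range D"
  have "inj_on ((`) j) (range D)"
    by (rule inj_on_subset[OF inj_on_image_Pow[OF j]]) (auto simp: D_def)
  then have "bij_betw ((`) j) (range D) \<D>"
    by (simp add: bij_betw_def \<D>_def)
  then have "|range D| =o |\<D>|"
    by (rule card_of_ordIsoI)
  then have card: "|\<D>| =o omega1"
    by (rule ordIso_transitive[OF ordIso_symmetric cardD])
  have disc: "has_uncountable_discrete_subspace (subtopology X Y)"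
    if G: "filter_in_poset (j ` P) (map_prod j j ` le) G" and meets: "\<forall>E\<in>\<D>. G \<inter> E \<noteq> {}" for G
  proof -
    define H where "H = {s\<in>P. j s \<in> G}"
    have H: "filter_in_poset P le H"
      unfolding H_def by (rule filter_in_poset_inj_vimage[OF j leP G])
    have "\<exists>b\<in>\<Union>H. a \<le> b" for a
    proof -
      have "G \<inter> j ` D a \<noteq> {}" using meets by (auto simp: \<D>_def)
      then obtain s where "s \<in> D a" "j s \<in> G" by blast
      then show ?thesis by (auto simp: D_def H_def)
    qed
    then have "uncountable (\<Union>H)"
      by (rule uncountable_unbounded_omega_1)
    moreover have "y a \<notin> U b" if ab: "a \<in> \<Union>H" "b \<in> \<Union>H" "a \<noteq> b" for a b
    proof -
      obtain s t where st: "s \<in> H" "a \<in> s" "t \<in> H" "b \<in> t" using ab by blast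
      then have "\<exists>r\<in>H. (r, s) \<in> le \<and> (r, t) \<in> le"
        using H unfolding filter_in_poset_def by blast
      then obtain r where "(r, s) \<in> le" "(r, t) \<in> le" by blast
      then have "r \<in> \<Q>" "a \<in> r" "b \<in> r"
        using st by (auto simp: le_def P_def)
      then show ?thesis
        using ab(3) by (simp add: \<Q>_def separation_conditions_def)
    qed
    ultimately show ?thesis
      by (rule separated_family_discrete[OF y(2,1) Y(1) _ U(1) U(2)])
  qed
  show ?thesis
  proof (intro exI conjI ballI impI)
    show "ccc_poset (j ` P) (map_prod j j ` le)"
      by (rule ccc_poset_inj_image[OF j cccP])
    show "dense_in_poset (j ` P) (map_prod j j ` le) E" if "E \<in> \<D>" for E
      using that dense_in_poset_image[OF dense] by (auto simp: \<D>_def)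
    show "|\<D>| =o omega1" by (rule card)
    show "has_uncountable_discrete_subspace (subtopology X Y)"
      if "\<exists>G. filter_in_poset (j ` P) (map_prod j j ` le) G \<and> (\<forall>E\<in>\<D>. G \<inter> E \<noteq> {})"
      using that disc by (elim exE conjE)
  qed
qed

theorem theorem1p1:
  fixes X :: "'a topology"
  assumes "uncountable (UNIV :: 'p set)"
    and "regular_space X" "t1_space X" "countably_tight X"
  shows
    "(\<forall>Y. Y \<subseteq> topspace X \<and> \<not> separable_space (subtopology X Y) \<and>
          (\<forall>n. Lindelof_space (power_topology X n)) \<longrightarrow>
        (\<exists>(P :: 'p set) le \<D>.
           ccc_poset P le \<and> (\<forall>D\<in>\<D>. dense_in_poset P le D) \<and> (card_of \<D>, omega1) \<in> ordIso \<and>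
           ((\<exists>G. filter_in_poset P le G \<and> (\<forall>D\<in>\<D>. G \<inter> D \<noteq> {})) \<longrightarrow>
              has_uncountable_discrete_subspace (subtopology X Y))))
     \<and>
     (MA_omega1 TYPE('p) \<and> (\<exists>Z. Z \<subseteq> topspace X \<and> L_space (subtopology X Z)) \<longrightarrow>
        (\<exists>n. \<not> Lindelof_space (power_topology X n)))"
proof (intro conjI allI impI)
  note forcing = ccc_poset_forcing_uncountable_discrete[where ?'p = 'p, OF assms(1,2,4)]
  show "\<exists>(P :: 'p set) le \<D>.
      ccc_poset P le \<and> (\<forall>D\<in>\<D>. dense_in_poset P le D) \<and> |\<D>| =o omega1 \<and>
      ((\<exists>G. filter_in_poset P le G \<and> (\<forall>D\<in>\<D>. G \<inter> D \<noteq> {})) \<longrightarrow>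
        has_uncountable_discrete_subspace (subtopology X Y))"
    if "Y \<subseteq> topspace X \<and> \<not> separable_space (subtopology X Y) \<and>
        (\<forall>n. Lindelof_space (power_topology X n))" for Y
    by (rule forcing) (use that in auto)
  assume MA: "MA_omega1 TYPE('p) \<and> (\<exists>Z. Z \<subseteq> topspace X \<and> L_space (subtopology X Z))"
  then obtain Z where Z: "Z \<subseteq> topspace X" "L_space (subtopology X Z)" by blast
  show "\<exists>n. \<not> Lindelof_space (power_topology X n)"
  proof (rule ccontr)
    assume "\<not> ?thesis"
    then have "\<And>n. Lindelof_space (power_topology X n)" by blast
    moreover have "\<not> separable_space (subtopology X Z)"
      using Z(2) by (simp add: L_space_def)
    ultimately have "\<exists>(P :: 'p set) le \<D>.
      ccc_poset P le \<and> (\<forall>D\<in>\<D>. dense_in_poset P le D) \<and> |\<D>| =o omega1 \<and>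
      ((\<exists>G. filter_in_poset P le G \<and> (\<forall>D\<in>\<D>. G \<inter> D \<noteq> {})) \<longrightarrow>
        has_uncountable_discrete_subspace (subtopology X Z))"
      by (intro forcing[OF Z(1)])
    then obtain P :: "'p set" and le \<D> where P: "ccc_poset P le" "\<forall>D\<in>\<D>. dense_in_poset P le D"
      and card: "|\<D>| =o omega1"
      and disc: "(\<exists>G. filter_in_poset P le G \<and> (\<forall>D\<in>\<D>. G \<inter> D \<noteq> {})) \<longrightarrow>
        has_uncountable_discrete_subspace (subtopology X Z)"
      by (elim exE conjE) (rule that)
    have "\<exists>G. filter_in_poset P le G \<and> (\<forall>D\<in>\<D>. G \<inter> D \<noteq> {})"
      using MA[THEN conjunct1, unfolded MA_omega1_def] P ordIso_imp_ordLeq[OF card] by simp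
    then have "has_uncountable_discrete_subspace (subtopology X Z)"
      by (rule disc[THEN mp])
    then show False
      using hereditarily_Lindelof_no_uncountable_discrete[of "subtopology X Z"] Z(2)
      by (simp add: L_space_def)
  qed
qed

end
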